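(* Let $h$ and $k$ be integers with $4\le h\le k-1$. If $A$ is an arithmetic progression of $k$ nonnegative integers with $0\in A$, then $\left|h^{\wedge}_{\pm}A\right|=2hk-h(h+1)+1$.
   Context: For a positive integer $h$ and a finite set of integers $A=\{a_1,\ldots,a_k\}$ (distinct elements), the restricted $h$-fold signed sumset is $h^{\wedge}_{\pm}A=\left\{\sum_{i=1}^k\lambda_i a_i:\lambda_i\in\{-1,0,1\},\ \sum_{i=1}^k|\lambda_i|=h\right\}$. *)

theory Defs
  imports Complex_Main
begin

(* The coefficients lambda_i are indexed by the elements a_i of A themselves; this is
   the same as indexing by 1..k because the a_i are distinct.  Meant for finite A. *)
definition restricted_signed_sumset :: "nat \<Rightarrow> int set \<Rightarrow> int set" where
  "restricted_signed_sumset h A =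
     {(\<Sum>a\<in>A. c a * a) | c :: int \<Rightarrow> int.
        (\<forall>a\<in>A. c a \<in> {-1, 0, 1}) \<and> (\<Sum>a\<in>A. \<bar>c a\<bar>) = int h}"

(* A set is an arithmetic progression of k terms irrespective of the order of listing, so
   the common difference may be taken positive; the k terms are then distinct. *)
definition is_arith_progression :: "nat \<Rightarrow> int set \<Rightarrow> bool" where
  "is_arith_progression k A \<longleftrightarrow>
     (\<exists>a d :: int. d > 0 \<and> A = {a + int i * d | i. i < k})"

end

(* Dividing by the common difference d reduces to A = {0,...,k-1}, and the claim becomes that the
   signed sums fill the whole interval [-M, M], where 2M = 2hk - h(h+1) is twice the sum of the
   h largest elements.  By symmetry consider m \<ge> 0.  Values at least 0 + 1 + ... + (h-1) are
   unsigned sums of h elements.  A smaller value of the parity of 0 + ... + (h-1) is a signed sum of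
   {0,...,h-1}, because every t \<le> 0 + ... + (h-1) is a subset sum.  A smaller value of the
   opposite parity is a signed sum of {0,...,h-2} \<union> {h} with +h; this reaches down to
   h - (h-1)(h-2)/2, which is at most 1 because h \<ge> 4. *)
theory Submission
  imports Defs
begin

section \<open>Rescaling by the common difference\<close>

definition signed_index_sums :: "nat \<Rightarrow> nat \<Rightarrow> int set" where
  "signed_index_sums k h =
     {(\<Sum>i<k. c i * int i) | c :: nat \<Rightarrow> int.
        (\<forall>i<k. c i \<in> {-1, 0, 1}) \<and> (\<Sum>i<k. \<bar>c i\<bar>) = int h}"

text \<open>As d > 0, i -> i * d is injective, so coefficients on elements and on indices
  correspond.\<close>

lemma restricted_signed_sumset_multiples:
  fixes d :: int
  assumes "d > 0"
  shows "restricted_signed_sumset h {int i * d | i. i < k} = (\<lambda>m. m * d) ` signed_index_sums k h"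
proof -
  define f where "f = (\<lambda>i. int i * d)"
  have inj: "inj f"
    using assms by (auto simp: f_def inj_def)
  have A: "{int i * d | i. i < k} = f ` {..<k}"
    by (auto simp: f_def)
  have reindex: "sum g (f ` {..<k}) = (\<Sum>i<k. g (f i))" for g :: "int \<Rightarrow> int"
    using inj by (subst sum.reindex) (auto intro: inj_on_subset)
  show ?thesis
  proof (intro equalityI subsetI)
    fix x assume "x \<in> restricted_signed_sumset h {int i * d | i. i < k}"
    then obtain c where c: "x = (\<Sum>i<k. c (f i) * f i)" "\<forall>i<k. c (f i) \<in> {-1, 0, 1}"
        "(\<Sum>i<k. \<bar>c (f i)\<bar>) = int h"
      unfolding restricted_signed_sumset_def A reindex by auto
    have "(\<Sum>i<k. c (f i) * int i) \<in> signed_index_sums k h"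
      unfolding signed_index_sums_def using c(2,3) by (intro CollectI exI[of _ "c \<circ> f"]) auto
    moreover have "x = (\<Sum>i<k. c (f i) * int i) * d"
      unfolding c(1) sum_distrib_right by (simp add: f_def mult.assoc)
    ultimately show "x \<in> (\<lambda>m. m * d) ` signed_index_sums k h" by blast
  next
    fix x assume "x \<in> (\<lambda>m. m * d) ` signed_index_sums k h"
    then obtain c where c: "x = (\<Sum>i<k. c i * int i) * d" "\<forall>i<k. c i \<in> {-1, 0, 1}"
        "(\<Sum>i<k. \<bar>c i\<bar>) = int h"
      unfolding signed_index_sums_def by auto
    have "x = (\<Sum>i<k. (c \<circ> inv f) (f i) * f i)"
      unfolding c(1) sum_distrib_right using inj by (simp add: f_def[symmetric] mult.assoc) (simp add: f_def)
    then show "x \<in> restricted_signed_sumset h {int i * d | i. i < k}"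
      unfolding restricted_signed_sumset_def A reindex
      using c(2,3) inj by (intro CollectI exI[of _ "c \<circ> inv f"]) auto
  qed
qed

section \<open>Symmetry and the upper bound\<close>

lemma signed_index_sums_uminus:
  assumes "m \<in> signed_index_sums k h"
  shows "- m \<in> signed_index_sums k h"
proof -
  obtain c where c: "m = (\<Sum>i<k. c i * int i)" "\<forall>i<k. c i \<in> {-1, 0, 1}"
      "(\<Sum>i<k. \<bar>c i\<bar>) = int h"
    using assms unfolding signed_index_sums_def by auto
  show ?thesis
    unfolding signed_index_sums_def using c
    by (intro CollectI exI[of _ "\<lambda>i. - c i"]) (auto simp: sum_negf)
qed

text \<open>H distinct indices below k sum to at most (k-1) + ... + (k-H). Doubling avoids a
  division.\<close>

lemma weighted_index_sum_le:
  fixes c :: "nat \<Rightarrow> int"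
  assumes "\<forall>i<k. c i \<in> {-1, 0, 1}"
  shows "2 * (\<Sum>i<k. \<bar>c i\<bar> * int i) + (\<Sum>i<k. \<bar>c i\<bar>) * ((\<Sum>i<k. \<bar>c i\<bar>) + 1)
           \<le> 2 * (\<Sum>i<k. \<bar>c i\<bar>) * int k"
  using assms
proof (induction k)
  case (Suc k)
  define H where "H = (\<Sum>i<k. \<bar>c i\<bar>)"
  define S where "S = (\<Sum>i<k. \<bar>c i\<bar> * int i)"
  have "H \<ge> 0" unfolding H_def by (intro sum_nonneg) auto
  moreover have "2 * S + H * (H + 1) \<le> 2 * H * int k"
    unfolding H_def S_def using Suc.prems by (intro Suc.IH) auto
  \<comment> \<open>If |c k| = 1, both sides grow by 2H + 2k + 2. If c k = 0, the left side stays
    and the right one grows by 2H.\<close>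
  moreover have "c k = 0 \<or> \<bar>c k\<bar> = 1" using Suc.prems by auto
  ultimately show ?case
    unfolding sum.lessThan_Suc H_def[symmetric] S_def[symmetric] by (elim disjE) (auto simp: algebra_simps)
qed simp

lemma signed_index_sums_bound:
  assumes "m \<in> signed_index_sums k h"
  shows "2 * \<bar>m\<bar> \<le> 2 * int h * int k - int h * (int h + 1)"
proof -
  obtain c where c: "m = (\<Sum>i<k. c i * int i)" "\<forall>i<k. c i \<in> {-1, 0, 1}"
      "(\<Sum>i<k. \<bar>c i\<bar>) = int h"
    using assms unfolding signed_index_sums_def by auto
  have "\<bar>m\<bar> \<le> (\<Sum>i<k. \<bar>c i\<bar> * int i)"
    unfolding c(1) by (rule order_trans[OF sum_abs]) (simp add: abs_mult)
  then show ?thesis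
    using weighted_index_sum_le[OF c(2)] unfolding c(3) by linarith
qed

section \<open>Realizing values by subset sums\<close>

lemma signed_subset_sum_mem:
  assumes "B \<subseteq> {..<k}" "card B = h" "P \<subseteq> B"
  shows "2 * (\<Sum>i\<in>P. int i) - (\<Sum>i\<in>B. int i) \<in> signed_index_sums k h"
proof -
  \<comment> \<open>Plus on \<open>P\<close> and minus on the rest of \<open>B\<close>: the total is
    sum P - (sum B - sum P).\<close>
  define c :: "nat \<Rightarrow> int" where "c i = (if i \<in> P then 1 else if i \<in> B then -1 else 0)" for i
  have fin: "finite B" using assms(1) finite_subset by blast
  have "(\<Sum>i<k. \<bar>c i\<bar>) = (\<Sum>i\<in>B. 1)"
    using assms by (intro sum.mono_neutral_cong_right) (auto simp: c_def)
  then have "(\<Sum>i<k. \<bar>c i\<bar>) = int h"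
    using assms(2) by simp
  moreover have "(\<Sum>i<k. c i * int i) = (\<Sum>i\<in>B. c i * int i)"
    using assms by (intro sum.mono_neutral_right) (auto simp: c_def)
  moreover have "\<dots> = (\<Sum>i\<in>B. 2 * (if i \<in> P then int i else 0) - int i)"
    using assms by (intro sum.cong) (auto simp: c_def)
  moreover have "\<dots> = 2 * (\<Sum>i\<in>P. int i) - (\<Sum>i\<in>B. int i)"
    using fin assms(3)
    by (simp add: sum_subtractf sum_distrib_left[symmetric] sum.inter_restrict[symmetric] Int_absorb1)
  ultimately show ?thesis
    unfolding signed_index_sums_def
    by (intro CollectI exI[of _ c]) (auto simp: c_def)
qed

lemma double_sum_lessThan: "2 * (\<Sum>i<n. int i) = int n * (int n - 1)"
  by (induction n) (auto simp: algebra_simps)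

lemma subset_sum_exists:
  fixes t :: int
  assumes "0 \<le> t" "t \<le> (\<Sum>i<n. int i)"
  shows "\<exists>P \<subseteq> {..<n}. (\<Sum>i\<in>P. int i) = t"
  using assms
proof (induction n arbitrary: t)
  case 0
  then show ?case by auto
next
  case (Suc n)
  show ?case
  proof (cases "t \<le> (\<Sum>i<n. int i)")
    case True
    then obtain P where "P \<subseteq> {..<n}" "(\<Sum>i\<in>P. int i) = t"
      using Suc by blast
    then show ?thesis by (intro exI[of _ P]) auto
  next
    case False
    \<comment> \<open>The element n can be taken greedily: t exceeds 0 + ... + (n-1), which is at
      least n for n >= 3 and at least n - 1 for n <= 2.\<close>
    have "t \<ge> int n"
    proof (cases "n \<le> 2")
      case True
      then have "n = 0 \<or> n = 1 \<or> n = 2" by auto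
      then show ?thesis using False Suc.prems by (auto simp: numeral_2_eq_2)
    next
      case nge: False
      then have "int n * 2 \<le> int n * (int n - 1)" by (intro mult_left_mono) auto
      then show ?thesis using False double_sum_lessThan[of n] by linarith
    qed
    then obtain P where P: "P \<subseteq> {..<n}" "(\<Sum>i\<in>P. int i) = t - int n"
      using Suc.IH[of "t - int n"] Suc.prems by auto
    have "finite P" "n \<notin> P" using P finite_subset by auto
    then show ?thesis
      using P by (intro exI[of _ "insert n P"]) auto
  qed
qed

text \<open>Passing from \<open>k\<close> to \<open>k + 1\<close> raises the maximum by \<open>h\<close>; the new values arise
  by omitting one element other than \<open>k\<close> from the top block \<open>{k - h..k}\<close>.\<close>
lemma card_subset_sum_exists:
  fixes m :: int
  assumes "h \<le> k" "int h * (int h - 1) \<le> 2 * m" "2 * m \<le> 2 * int h * int k - int h * (int h + 1)"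
  shows "\<exists>P \<subseteq> {..<k}. card P = h \<and> (\<Sum>i\<in>P. int i) = m"
  using assms
proof (induction k rule: dec_induct)
  \<comment> \<open>At k = h the two bounds coincide and force m = 0 + ... + (h-1).\<close>
  case base
  then show ?case
    using double_sum_lessThan[of h] by (intro exI[of _ "{..<h}"]) (auto simp: algebra_simps)
next
  case (step k)
  show ?case
  proof (cases "2 * m \<le> 2 * int h * int k - int h * (int h + 1)")
    case True
    then obtain P where "P \<subseteq> {..<k}" "card P = h \<and> (\<Sum>i\<in>P. int i) = m"
      using step by blast
    then show ?thesis by (intro exI[of _ P]) auto
  next
    case False
    define S where "S = (\<Sum>i\<in>{k - h..<Suc k}. int i)"
    have "(\<Sum>i<Suc k. int i) = (\<Sum>i<k - h. int i) + S"
      unfolding S_def by (metis atLeast0LessThan diff_le_self le_SucI sum.atLeastLessThan_concat zero_le)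
    then have "2 * S = int (Suc k) * (int (Suc k) - 1) - int (k - h) * (int (k - h) - 1)"
      using double_sum_lessThan[of "Suc k"] double_sum_lessThan[of "k - h"] by linarith
    then have S: "2 * S = 2 * int h * int k - int h * (int h + 1) + 2 * int k"
      using step.hyps(1) by (simp add: of_nat_diff algebra_simps)
    \<comment> \<open>The block has h + 1 elements with sum \<open>S\<close>, so x is the element to
      omit. Failure of the old bound gives x < k, the new bound gives x >= k - h.\<close>
    define x where "x = nat (S - m)"
    have bounds: "S - m < int k" "S - m \<ge> int k - int h"
      using S False step.prems by (auto simp: algebra_simps)
    then have ix: "int x = S - m" using step.hyps(1) unfolding x_def by auto
    have x: "x \<in> {k - h..<Suc k}"
      using ix bounds step.hyps(1) by auto
    have "card ({k - h..<Suc k} - {x}) = h"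
      using x step.hyps(1) by simp
    moreover have "(\<Sum>i\<in>{k - h..<Suc k} - {x}. int i) = m"
      using x ix by (simp add: sum_diff1 S_def)
    ultimately show ?thesis
      by (intro exI[of _ "{k - h..<Suc k} - {x}"]) auto
  qed
qed

lemma small_mem_signed_index_sums:
  fixes m :: int
  assumes "4 \<le> h" "h + 1 \<le> k" "0 \<le> m" "2 * m \<le> int h * (int h - 1)"
  shows "m \<in> signed_index_sums k h"
proof -
  define s where "s = (\<Sum>i<h - 1. int i)"
  obtain n where h: "h = Suc n" using assms(1) by (cases h) auto
  have s: "(\<Sum>i<h. int i) = s + int h - 1" and s2: "2 * s = (int h - 1) * (int h - 2)"
    using double_sum_lessThan[of n] by (auto simp: s_def h)
  have "int h * (int h - 1) = (int h - 1) * (int h - 2) + 2 * (int h - 1)"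
    by (simp add: algebra_simps)
  then have m_le: "m \<le> s + int h - 1"
    using assms(4) s2 by (simp add: algebra_simps)
  show ?thesis
  proof (cases "even (m + s + int h - 1)")
    case True
    \<comment> \<open>Solves 2t - (0 + ... + (h-1)) = m, where t is the sum of the elements with
      sign plus.\<close>
    define t where "t = (m + s + int h - 1) div 2"
    have t: "2 * t = m + s + int h - 1" using True by (simp add: t_def)
    have "s \<ge> 0" unfolding s_def by (intro sum_nonneg) auto
    then obtain P where P: "P \<subseteq> {..<h}" "(\<Sum>i\<in>P. int i) = t"
      using subset_sum_exists[of t h] t s m_le assms(1,3) by auto
    show ?thesis
      using signed_subset_sum_mem[of "{..<h}" k h P] P s t assms(2) by auto
  next
    case False
    \<comment> \<open>Here h >= 4 enters, as h - 2 >= 2.\<close>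
    have "(int h - 1) * 2 \<le> 2 * s"
      unfolding s2 using assms(1) by (intro mult_left_mono) auto
    then have s_ge: "s \<ge> int h - 1" by simp
    \<comment> \<open>Solves 2(h + t) - (h + s) = m, where h + t is the sum of the elements with
      sign plus.\<close>
    define t where "t = (m + s - int h) div 2"
    have "m + s + int h - 1 = (m + s - int h) + (2 * int h - 1)" by simp
    then have "even (m + s - int h)" using False by presburger
    then have t: "2 * t = m + s - int h" by (simp add: t_def)
    \<comment> \<open>The bounds give only 2t >= -1; integrality of t excludes -1.\<close>
    have "t \<ge> 0" "t \<le> s" using t s_ge m_le assms(3) by auto
    then obtain P where P: "P \<subseteq> {..<h - 1}" "(\<Sum>i\<in>P. int i) = t"
      using subset_sum_exists[of t "h - 1"] unfolding s_def by auto
    have "finite P" "h \<notin> P" using P finite_subset by auto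
    then have "(\<Sum>i\<in>insert h P. int i) = int h + t" using P by simp
    moreover have "(\<Sum>i\<in>insert h {..<h - 1}. int i) = int h + s" by (simp add: s_def)
    moreover have "2 * (\<Sum>i\<in>insert h P. int i) - (\<Sum>i\<in>insert h {..<h - 1}. int i)
        \<in> signed_index_sums k h"
      using P(1) assms(1,2) by (intro signed_subset_sum_mem) auto
    moreover have "2 * (int h + t) - (int h + s) = m" using t by simp
    ultimately show ?thesis by simp
  qed
qed

section \<open>The full interval and its cardinality\<close>

lemma mem_signed_index_sums_iff:
  assumes "4 \<le> h" "h + 1 \<le> k"
  shows "m \<in> signed_index_sums k h \<longleftrightarrow> 2 * \<bar>m\<bar> \<le> 2 * int h * int k - int h * (int h + 1)"
proof
  assume bound: "2 * \<bar>m\<bar> \<le> 2 * int h * int k - int h * (int h + 1)"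
  have "\<bar>m\<bar> \<in> signed_index_sums k h"
  proof (cases "2 * \<bar>m\<bar> \<le> int h * (int h - 1)")
    case True
    then show ?thesis using small_mem_signed_index_sums[of h k "\<bar>m\<bar>"] assms by simp
  next
    case False
    then obtain P where P: "P \<subseteq> {..<k}" "card P = h" "(\<Sum>i\<in>P. int i) = \<bar>m\<bar>"
      using card_subset_sum_exists[of h k "\<bar>m\<bar>"] bound assms(2) by auto
    \<comment> \<open>With \<open>P\<close> in both roles all signs are plus.\<close>
    show ?thesis using signed_subset_sum_mem[OF P(1,2) order_refl] P(3) by simp
  qed
  then show "m \<in> signed_index_sums k h"
    using signed_index_sums_uminus[of "\<bar>m\<bar>" k h] by (cases "m \<ge> 0") auto
qed (rule signed_index_sums_bound)

theorem theorem2p6: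
  fixes h k :: nat and A :: "int set"
  assumes "4 \<le> h" and "h \<le> k - 1"
    and "is_arith_progression k A"
    and "\<forall>x\<in>A. x \<ge> 0" and "0 \<in> A"
  shows "int (card (restricted_signed_sumset h A)) =
           2 * int h * int k - int h * (int h + 1) + 1"
proof -
  have hk: "h + 1 \<le> k" using assms(1,2) by auto
  obtain a d :: int where d: "d > 0" and A: "A = {a + int i * d | i. i < k}"
    using assms(3) unfolding is_arith_progression_def by auto
  \<comment> \<open>The term \<open>a\<close> is nonnegative, and at most 0 because 0 is a term a +
    i * d.\<close>
  have "a + int 0 * d \<in> A" unfolding A using hk by (intro CollectI exI[of _ 0]) simp
  then have "a \<ge> 0" using assms(4) by auto
  moreover obtain i where "0 = a + int i * d" using assms(5) A by auto
  moreover have "int i * d \<ge> 0" using d by simp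
  ultimately have "a = 0" by linarith
  then have A: "A = {int i * d | i. i < k}" using A by simp
  \<comment> \<open>Parity makes the extreme value M an integer; M >= 0 then gives {-M..M} exactly
    2M + 1 elements.\<close>
  have "even (int h * (int h + 1))" by simp
  then obtain q where q: "int h * (int h + 1) = 2 * q" by (elim evenE)
  define M where "M = int h * int k - q"
  have M: "2 * int h * int k - int h * (int h + 1) = 2 * M" unfolding M_def q by simp
  have "int h * (int h + 1) \<le> int h * int k" using hk by (intro mult_left_mono) auto
  moreover have "0 \<le> int h * int k" by simp
  ultimately have "M \<ge> 0" using q unfolding M_def by linarith
  have "signed_index_sums k h = {-M..M}"
    unfolding set_eq_iff mem_signed_index_sums_iff[OF assms(1) hk] M by (auto simp: abs_le_iff)
  moreover have "inj (\<lambda>m. m * d)" using d by (auto simp: inj_def)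
  ultimately have "card (restricted_signed_sumset h A) = card {-M..M}"
    unfolding A restricted_signed_sumset_multiples[OF d]
    by (metis card_image inj_on_subset subset_UNIV)
  then show ?thesis unfolding M using \<open>M \<ge> 0\<close> by simp
qed

end
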